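(* In any transition system, for all processes $p,q$: $p\lesssim^{F}q\iff\mathcal{L}_\omega(p)\subseteq\mathcal{L}_\omega(q)$.
   Context: A transition system is $(\mathrm{Proc},\mathsf{Act},\rightarrow,\uparrow)$ with ${\rightarrow}\subseteq\mathrm{Proc}\times\mathsf{Act}\times\mathrm{Proc}$ (written $p\xrightarrow{a}q$), ${\uparrow}\subseteq\mathrm{Proc}$; $p\downarrow$ means not $p\uparrow$. A prebisimulation is a relation $R$ such that $pRq$ implies, for all $a$: (1) $p\xrightarrow{a}p'$ implies $\exists q'.\,q\xrightarrow{a}q'\wedge p'Rq'$; (2) $p\downarrow$ implies $q\downarrow$ and ($q\xrightarrow{a}q'$ implies $\exists p'.\,p\xrightarrow{a}p'\wedge p'Rq'$). $\lesssim^B$ is the largest prebisimulation (processes of different systems compared in the disjoint union). Finite synchronisation trees $\mathsf{ST}_\omega(\mathsf{Act})$: terms $\sum_{i\in I}a_it_i$ and $\sum_{i\in I}a_it_i+\Omega$ with $I$ finite, $a_i\in\mathsf{Act}$, $t_i$ finite trees; as a transition system, $t\uparrow$ iff $\Omega$ is a summand and $t\xrightarrow{a_i}t_i$ for each summand. The finitary preorder: $p\lesssim^F q$ iff for all $t\in\mathsf{ST}_\omega(\mathsf{Act})$, $t\lesssim^Bp$ implies $t\lesssim^Bq$. $\mathcal{L}_\omega$: sorts $\pi,\kappa$; finite conjunctions/disjunctions within a sort; $a(\phi)$ (sort $\kappa$) for $\phi$ of sort $\pi$; $\Box\phi,\Diamond\phi$ (sort $\pi$) for $\phi$ of sort $\kappa$.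 With $C(p)=\{\bot:p\uparrow\}\cup\{\langle a,q\rangle:p\xrightarrow{a}q\}$: $p\models\Box\phi$ iff all $c\in C(p)$ satisfy $\phi$; $p\models\Diamond\phi$ iff some $c\in C(p)\cup\{\bot\}$ satisfies $\phi$; $c\models a(\phi)$ iff $c=\langle a,q\rangle$ with $q\models\phi$. $\mathcal{L}_\omega(p)$ = sort-$\pi$ formulas satisfied by $p$. *)

theory Defs
  imports Main
begin

section \<open>Transition systems with divergence\<close>

record ('p, 'a) transition_system =
  steps :: "('p \<times> 'a \<times> 'p) set"
  divergent :: "'p set"

definition converges :: "('p, 'a) transition_system \<Rightarrow> 'p \<Rightarrow> bool" where
  "converges S p \<longleftrightarrow> p \<notin> divergent S"

definition disjoint_union ::
  "('p, 'a) transition_system \<Rightarrow> ('q, 'a) transition_system \<Rightarrow> ('p + 'q, 'a) transition_system" where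
  "disjoint_union S T =
     \<lparr> steps = {(Inl p, a, Inl p') | p a p'. (p, a, p') \<in> steps S}
             \<union> {(Inr q, a, Inr q') | q a q'. (q, a, q') \<in> steps T},
       divergent = divergent S <+> divergent T \<rparr>"


section \<open>Prebisimulation\<close>

definition prebisimulation :: "('p, 'a) transition_system \<Rightarrow> ('p \<times> 'p) set \<Rightarrow> bool" where
  "prebisimulation S R \<longleftrightarrow>
     (\<forall>(p, q) \<in> R. \<forall>a.
        (\<forall>p'. (p, a, p') \<in> steps S \<longrightarrow> (\<exists>q'. (q, a, q') \<in> steps S \<and> (p', q') \<in> R)) \<and>
        (converges S p \<longrightarrow>
           converges S q \<and>
           (\<forall>q'. (q, a, q') \<in> steps S \<longrightarrow> (\<exists>p'. (p, a, p') \<in> steps S \<and> (p', q') \<in> R))))"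

definition prebisimilarity :: "('p, 'a) transition_system \<Rightarrow> ('p \<times> 'p) set" where
  "prebisimilarity S = \<Union> {R. prebisimulation S R}"

lemma prebisimulation_prebisimilarity: "prebisimulation S (prebisimilarity S)"
proof -
  have *: "\<And>R r. prebisimulation S R \<Longrightarrow> r \<in> R \<Longrightarrow> r \<in> prebisimilarity S"
    unfolding prebisimilarity_def by blast
  show ?thesis
    unfolding prebisimulation_def [of S "prebisimilarity S"]
  proof (clarify)
    fix p q a
    assume "(p, q) \<in> prebisimilarity S"
    then obtain R where R: "prebisimulation S R" and pq: "(p, q) \<in> R"
      unfolding prebisimilarity_def by blast
    have step: "(\<forall>p'. (p, a, p') \<in> steps S \<longrightarrow> (\<exists>q'. (q, a, q') \<in> steps S \<and> (p', q') \<in> R)) \<and>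
        (converges S p \<longrightarrow> converges S q \<and>
           (\<forall>q'. (q, a, q') \<in> steps S \<longrightarrow> (\<exists>p'. (p, a, p') \<in> steps S \<and> (p', q') \<in> R)))"
      using bspec [OF R [unfolded prebisimulation_def] pq] by simp
    show "(\<forall>p'. (p, a, p') \<in> steps S \<longrightarrow>
            (\<exists>q'. (q, a, q') \<in> steps S \<and> (p', q') \<in> prebisimilarity S)) \<and>
        (converges S p \<longrightarrow> converges S q \<and>
           (\<forall>q'. (q, a, q') \<in> steps S \<longrightarrow>
             (\<exists>p'. (p, a, p') \<in> steps S \<and> (p', q') \<in> prebisimilarity S)))"
      using step * [OF R] by meson
  qed
qed

lemma prebisimilarity_greatest: "prebisimulation S R \<Longrightarrow> R \<subseteq> prebisimilarity S"
  unfolding prebisimilarity_def by blast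

definition prebisimilar_across ::
  "('p, 'a) transition_system \<Rightarrow> ('q, 'a) transition_system \<Rightarrow> 'p \<Rightarrow> 'q \<Rightarrow> bool" where
  "prebisimilar_across S T p q \<longleftrightarrow> (Inl p, Inr q) \<in> prebisimilarity (disjoint_union S T)"


section \<open>Finite synchronisation trees and the finitary preorder\<close>

text \<open>Terms are kept as syntax: the finite index set of a sum is rendered by a list, and
  \<open>SumOmega\<close> is the sum with the additional summand \<open>\<Omega>\<close>.\<close>

datatype 'a sync_tree =
    Sum "('a \<times> 'a sync_tree) list"
  | SumOmega "('a \<times> 'a sync_tree) list"

fun summands :: "'a sync_tree \<Rightarrow> ('a \<times> 'a sync_tree) list" where
  "summands (Sum ts) = ts"
| "summands (SumOmega ts) = ts"

definition tree_system :: "('a sync_tree, 'a) transition_system" where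
  "tree_system =
     \<lparr> steps = {(t, a, t'). (a, t') \<in> set (summands t)},
       divergent = range SumOmega \<rparr>"

definition finitary_preorder :: "('p, 'a) transition_system \<Rightarrow> 'p \<Rightarrow> 'p \<Rightarrow> bool" where
  "finitary_preorder S p q \<longleftrightarrow>
     (\<forall>t :: 'a sync_tree.
        prebisimilar_across tree_system S t p \<longrightarrow> prebisimilar_across tree_system S t q)"


section \<open>The finitary domain logic\<close>

text \<open>The empty conjunction and disjunction, i.e. truth and falsity, are included at both sorts.\<close>

datatype 'a pi_formula =
    PiConj "'a pi_formula list"
  | PiDisj "'a pi_formula list"
  | Box "'a kappa_formula"
  | Diamond "'a kappa_formula"
and 'a kappa_formula =
    KappaConj "'a kappa_formula list"
  | KappaDisj "'a kappa_formula list"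
  | Prefix 'a "'a pi_formula"

datatype ('p, 'a) capability = Bot | Cap 'a 'p

definition capabilities :: "('p, 'a) transition_system \<Rightarrow> 'p \<Rightarrow> ('p, 'a) capability set" where
  "capabilities S p = (if p \<in> divergent S then {Bot} else {}) \<union> {Cap a q | a q. (p, a, q) \<in> steps S}"

fun sat_pi :: "('p, 'a) transition_system \<Rightarrow> 'p \<Rightarrow> 'a pi_formula \<Rightarrow> bool"
and sat_kappa :: "('p, 'a) transition_system \<Rightarrow> ('p, 'a) capability \<Rightarrow> 'a kappa_formula \<Rightarrow> bool"
where
  "sat_pi S p (PiConj \<phi>s) \<longleftrightarrow> (\<forall>\<phi> \<in> set \<phi>s. sat_pi S p \<phi>)"
| "sat_pi S p (PiDisj \<phi>s) \<longleftrightarrow> (\<exists>\<phi> \<in> set \<phi>s. sat_pi S p \<phi>)"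
| "sat_pi S p (Box \<phi>) \<longleftrightarrow> (\<forall>c \<in> capabilities S p. sat_kappa S c \<phi>)"
| "sat_pi S p (Diamond \<phi>) \<longleftrightarrow> (\<exists>c \<in> capabilities S p \<union> {Bot}. sat_kappa S c \<phi>)"
| "sat_kappa S c (KappaConj \<phi>s) \<longleftrightarrow> (\<forall>\<phi> \<in> set \<phi>s. sat_kappa S c \<phi>)"
| "sat_kappa S c (KappaDisj \<phi>s) \<longleftrightarrow> (\<exists>\<phi> \<in> set \<phi>s. sat_kappa S c \<phi>)"
| "sat_kappa S c (Prefix a \<phi>) \<longleftrightarrow> (\<exists>q. c = Cap a q \<and> sat_pi S q \<phi>)"

definition finitary_theory :: "('p, 'a) transition_system \<Rightarrow> 'p \<Rightarrow> 'a pi_formula set" where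
  "finitary_theory S p = {\<phi>. sat_pi S p \<phi>}"

end

(* Both implications rest on finite trees and formulas approximating each other.  Every tree t has a
   characteristic formula that holds exactly at the processes above t.  Conversely, if p satisfies
   phi then so does the truncation of p to the finitely many actions and to the size of phi, which
   is a finite tree below p.  A convergent process with a step whose action is not in phi may be
   truncated to a divergent tree, since a sort-kappa formula that holds at such a step also holds
   at bottom. *)
theory Submission imports Defs begin

section \<open>Prebisimilarity between two systems\<close>

lemma prebisimilar_across_coinduct:
  assumes "R p q"
    and "\<And>p q a p'. R p q \<Longrightarrow> (p, a, p') \<in> steps S \<Longrightarrow> \<exists>q'. (q, a, q') \<in> steps T \<and> R p' q'"
    and "\<And>p q. R p q \<Longrightarrow> converges S p \<Longrightarrow> converges T q"
    and "\<And>p q a q'. R p q \<Longrightarrow> converges S p \<Longrightarrow> (q, a, q') \<in> steps T \<Longrightarrow>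
           \<exists>p'. (p, a, p') \<in> steps S \<and> R p' q'"
  shows "prebisimilar_across S T p q"
proof -
  let ?R = "{(Inl p, Inr q) | p q. R p q}"
  have "prebisimulation (disjoint_union S T) ?R"
    unfolding prebisimulation_def
  proof (clarify, intro conjI allI impI)
    fix p q a p' assume "R p q" "(Inl p, a, p') \<in> steps (disjoint_union S T)"
    then show "\<exists>q'. (Inr q, a, q') \<in> steps (disjoint_union S T) \<and> (p', q') \<in> ?R"
      using assms(2) by (fastforce simp: disjoint_union_def)
  next
    fix p q assume "R p q" "converges (disjoint_union S T) (Inl p)"
    then show "converges (disjoint_union S T) (Inr q)"
      using assms(3) by (auto simp: disjoint_union_def converges_def)
  next
    fix p q a q' assume "R p q" "converges (disjoint_union S T) (Inl p)"
      and step: "(Inr q, a, q') \<in> steps (disjoint_union S T)"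
    moreover from this have "converges S p"
      by (auto simp: disjoint_union_def converges_def)
    moreover obtain r where "q' = Inr r" "(q, a, r) \<in> steps T"
      using step by (auto simp: disjoint_union_def)
    ultimately show "\<exists>p'. (Inl p, a, p') \<in> steps (disjoint_union S T) \<and> (p', q') \<in> ?R"
      using assms(4) [of p q a r] by (auto simp: disjoint_union_def)
  qed
  then have "?R \<subseteq> prebisimilarity (disjoint_union S T)"
    by (rule prebisimilarity_greatest)
  then show ?thesis
    using assms(1) by (auto simp: prebisimilar_across_def)
qed

text \<open>In the disjoint union, steps from \<open>Inl p\<close> stay on the left and steps from
  \<open>Inr q\<close> on the right, so the derivatives are again compared across the two
  systems.\<close>

lemma
  assumes "prebisimilar_across S T p q"
  shows prebisimilar_across_step:
      "(p, a, p') \<in> steps S \<Longrightarrow> \<exists>q'. (q, a, q') \<in> steps T \<and> prebisimilar_across S T p' q'"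
    and prebisimilar_across_converges: "converges S p \<Longrightarrow> converges T q"
    and prebisimilar_across_step_back: "converges S p \<Longrightarrow> (q, a, q') \<in> steps T \<Longrightarrow>
      \<exists>p'. (p, a, p') \<in> steps S \<and> prebisimilar_across S T p' q'"
proof -
  let ?U = "disjoint_union S T" and ?R = "prebisimilarity (disjoint_union S T)"
  have *: "(\<forall>p'. (Inl p, a, p') \<in> steps ?U \<longrightarrow> (\<exists>q'. (Inr q, a, q') \<in> steps ?U \<and> (p', q') \<in> ?R)) \<and>
      (converges ?U (Inl p) \<longrightarrow> converges ?U (Inr q) \<and>
        (\<forall>q'. (Inr q, a, q') \<in> steps ?U \<longrightarrow> (\<exists>p'. (Inl p, a, p') \<in> steps ?U \<and> (p', q') \<in> ?R)))"
    for a
    using bspec [OF prebisimulation_prebisimilarity [unfolded prebisimulation_def]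
        assms [unfolded prebisimilar_across_def]] by simp
  have left: "(Inl p, a, x) \<in> steps ?U \<longleftrightarrow> (\<exists>p'. x = Inl p' \<and> (p, a, p') \<in> steps S)"
    and right: "(Inr q, a, y) \<in> steps ?U \<longleftrightarrow> (\<exists>q'. y = Inr q' \<and> (q, a, q') \<in> steps T)"
    and conv: "converges ?U (Inl p) \<longleftrightarrow> converges S p" "converges ?U (Inr q) \<longleftrightarrow> converges T q"
    for a x y
    by (auto simp: disjoint_union_def converges_def)
  show "\<exists>q'. (q, a, q') \<in> steps T \<and> prebisimilar_across S T p' q'" if "(p, a, p') \<in> steps S"
    using * [of a] that unfolding left right prebisimilar_across_def by blast
  show "converges T q" if "converges S p"
    using * that unfolding conv by blast
  show "\<exists>p'. (p, a, p') \<in> steps S \<and> prebisimilar_across S T p' q'"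
    if "converges S p" "(q, a, q') \<in> steps T"
    using * [of a] that unfolding left right conv prebisimilar_across_def by blast
qed

section \<open>Monotonicity of satisfaction\<close>

lemma mem_capabilities [simp]:
  "Bot \<in> capabilities S p \<longleftrightarrow> \<not> converges S p"
  "Cap a q \<in> capabilities S p \<longleftrightarrow> (p, a, q) \<in> steps S"
  by (auto simp: capabilities_def converges_def)

text \<open>Every \<open>Prefix\<close> formula fails at \<open>Bot\<close>, so
  \<open>\<psi>\<close> holds there by its conjunctions and disjunctions alone, hence at any
  capability of any system. The claim \<open>True\<close> only fills the other half of the mutual
  induction.\<close>

lemma sat_kappa_Bot:
  fixes \<phi> :: "'a pi_formula" and \<psi> :: "'a kappa_formula"
  shows "True" and "sat_kappa S Bot \<psi> \<Longrightarrow> sat_kappa T c \<psi>"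
  by (induction \<phi> and \<psi>) auto

text \<open>The preorder lifted from processes to capabilities, with \<open>Bot\<close> least; it
  gives sort kappa its half of the monotonicity induction.\<close>

inductive capability_le ::
  "('p, 'a) transition_system \<Rightarrow> ('q, 'a) transition_system \<Rightarrow>
    ('p, 'a) capability \<Rightarrow> ('q, 'a) capability \<Rightarrow> bool" for S T where
  Bot_le: "capability_le S T Bot c"
| Cap_le: "prebisimilar_across S T p q \<Longrightarrow> capability_le S T (Cap a p) (Cap a q)"

text \<open>\<open>Diamond\<close> follows from the forward clause of prebisimulation and
  \<open>Box\<close> from the backward clause. The latter needs \<open>p\<close> to converge; if
  \<open>p\<close> diverges, \<open>Box \<psi>\<close> makes \<open>\<psi>\<close> true at
  \<open>Bot\<close> and so everywhere.\<close>

lemma sat_mono: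
  fixes \<phi> :: "'a pi_formula" and \<psi> :: "'a kappa_formula"
  shows sat_pi_mono: "prebisimilar_across S T p q \<Longrightarrow> sat_pi S p \<phi> \<Longrightarrow> sat_pi T q \<phi>"
    and sat_kappa_mono: "capability_le S T c d \<Longrightarrow> sat_kappa S c \<psi> \<Longrightarrow> sat_kappa T d \<psi>"
proof (induction \<phi> and \<psi> arbitrary: p q and c d)
  case (Box \<psi>)
  show ?case
  proof (cases "converges S p")
    case False
    then show ?thesis
      using Box.prems(2) by (auto intro: sat_kappa_Bot(2))
  next
    case True
    have "sat_kappa T d \<psi>" if d: "d \<in> capabilities T q" for d
    proof (cases d)
      case Bot
      then show ?thesis
        using d prebisimilar_across_converges [OF Box.prems(1) True] by simp
    next
      case (Cap a q')
      then obtain p' where "(p, a, p') \<in> steps S" "prebisimilar_across S T p' q'"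
        using d prebisimilar_across_step_back [OF Box.prems(1) True, of a q'] by auto
      then show ?thesis
        using Box.IH [OF Cap_le] Box.prems(2) Cap by simp
    qed
    then show ?thesis by simp
  qed
next
  case (Diamond \<psi>)
  then obtain c where c: "c \<in> capabilities S p \<union> {Bot}" "sat_kappa S c \<psi>"
    by auto
  show ?case
  proof (cases c)
    case Bot
    then show ?thesis
      using c(2) by (auto intro: sat_kappa_Bot(2))
  next
    case (Cap a p')
    then obtain q' where "(q, a, q') \<in> steps T" "prebisimilar_across S T p' q'"
      using c(1) prebisimilar_across_step [OF Diamond.prems(1)] by fastforce
    then show ?thesis
      using Diamond.IH [OF Cap_le [of S T p' q' a]] c(2) Cap by auto
  qed
next
  case (Prefix a \<phi>)
  then show ?case by (auto elim: capability_le.cases)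
qed auto

section \<open>Characteristic formulas of finite trees\<close>

fun char_formula :: "'a sync_tree \<Rightarrow> 'a pi_formula" where
  "char_formula (Sum ts) =
     PiConj (Box (KappaDisj (map (\<lambda>(a, t). Prefix a (char_formula t)) ts)) #
       map (\<lambda>(a, t). Diamond (Prefix a (char_formula t))) ts)"
| "char_formula (SumOmega ts) = PiConj (map (\<lambda>(a, t). Diamond (Prefix a (char_formula t))) ts)"

lemma mem_steps_tree_system [simp]:
  "(t, a, t') \<in> steps tree_system \<longleftrightarrow> (a, t') \<in> set (summands t)"
  by (simp add: tree_system_def)

lemma converges_tree_system [simp]:
  "converges tree_system (Sum ts)" "\<not> converges tree_system (SumOmega ts)"
  by (auto simp: tree_system_def converges_def)

lemma sat_pi_Diamond_Prefix:
  "sat_pi S p (Diamond (Prefix a \<phi>)) \<longleftrightarrow> (\<exists>q. (p, a, q) \<in> steps S \<and> sat_pi S q \<phi>)"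
  by auto

text \<open>A disjunction of \<open>Prefix\<close> formulas fails at \<open>Bot\<close>, which is
  why the \<open>Box\<close> also forces convergence.\<close>

lemma sat_pi_Box_Prefixes:
  "sat_pi S p (Box (KappaDisj (map (\<lambda>(a, t). Prefix a (f t)) ts))) \<longleftrightarrow>
    converges S p \<and> (\<forall>a q. (p, a, q) \<in> steps S \<longrightarrow> (\<exists>t. (a, t) \<in> set ts \<and> sat_pi S q (f t)))"
  (is "?L \<longleftrightarrow> ?R")
proof
  assume L: ?L
  then have "converges S p"
    by (auto dest!: bspec [of _ _ Bot])
  moreover have "\<exists>t. (a, t) \<in> set ts \<and> sat_pi S q (f t)" if "(p, a, q) \<in> steps S" for a q
    using L that by (auto dest!: bspec [of _ _ "Cap a q"])
  ultimately show ?R by blast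
next
  assume R: ?R
  have "\<exists>t\<in>set ts. case t of (a, t) \<Rightarrow> \<exists>q. c = Cap a q \<and> sat_pi S q (f t)"
    if "c \<in> capabilities S p" for c
    using R that by (cases c) fastforce+
  then show ?L by (auto simp: split_def)
qed

text \<open>These are the clauses of a prebisimulation between \<open>t\<close> and
  \<open>p\<close>: the \<open>Diamond\<close> conjuncts give the forward clause, the
  \<open>Box\<close> of a \<open>Sum\<close> the clause for convergent trees.\<close>

lemma sat_pi_char_formula_iff:
  "sat_pi S p (char_formula t) \<longleftrightarrow>
    (\<forall>(a, t') \<in> set (summands t). \<exists>q. (p, a, q) \<in> steps S \<and> sat_pi S q (char_formula t')) \<and>
    (converges tree_system t \<longrightarrow> converges S p \<and>
      (\<forall>a q. (p, a, q) \<in> steps S \<longrightarrow>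
        (\<exists>t'. (a, t') \<in> set (summands t) \<and> sat_pi S q (char_formula t'))))"
proof (cases t)
  case (Sum ts)
  show ?thesis
    unfolding Sum char_formula.simps sat_pi.simps(1) list.set ball_simps(7) sat_pi_Box_Prefixes
    by (auto simp del: sat_pi.simps(4) simp add: sat_pi_Diamond_Prefix)
next
  case (SumOmega ts)
  then show ?thesis
    by (auto simp del: sat_pi.simps(4) simp add: sat_pi_Diamond_Prefix)
qed

lemma sat_pi_char_formula_self: "sat_pi tree_system t (char_formula t)"
proof (induction t)
  case (Sum ts)
  have "sat_pi tree_system t' (char_formula t')" if "(a, t') \<in> set ts" for a t'
    by (rule Sum.IH [OF that]) simp
  then show ?case
    unfolding sat_pi_char_formula_iff [of _ "Sum ts"] by auto
next
  case (SumOmega ts)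
  have "sat_pi tree_system t' (char_formula t')" if "(a, t') \<in> set ts" for a t'
    by (rule SumOmega.IH [OF that]) simp
  then show ?case
    unfolding sat_pi_char_formula_iff [of _ "SumOmega ts"] by auto
qed

text \<open>Satisfaction of characteristic formulas is itself a prebisimulation. Conversely,
  \<open>t\<close> satisfies its own formula, and monotonicity passes it on to
  \<open>p\<close>.\<close>

lemma sat_pi_char_formula:
  "sat_pi S p (char_formula t) \<longleftrightarrow> prebisimilar_across tree_system S t p"
proof
  assume "sat_pi S p (char_formula t)"
  then show "prebisimilar_across tree_system S t p"
  proof (rule prebisimilar_across_coinduct [where R = "\<lambda>t p. sat_pi S p (char_formula t)"])
    fix t p assume *: "sat_pi S p (char_formula t)"
    note * = * [unfolded sat_pi_char_formula_iff [of S p t]]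
    show "\<exists>q. (p, a, q) \<in> steps S \<and> sat_pi S q (char_formula t')"
      if "(t, a, t') \<in> steps tree_system" for a t'
      using * that by auto
    show "converges S p" if "converges tree_system t"
      using * that by blast
    show "\<exists>t'. (t, a, t') \<in> steps tree_system \<and> sat_pi S q (char_formula t')"
      if "converges tree_system t" "(p, a, q) \<in> steps S" for a q
      using * that by auto
  qed
qed (metis sat_pi_mono sat_pi_char_formula_self)

section \<open>Truncations to finite trees\<close>

fun truncation :: "('p, 'a) transition_system \<Rightarrow> 'a set \<Rightarrow> nat \<Rightarrow> 'p \<Rightarrow> 'a sync_tree" where
  "truncation S A 0 p = SumOmega []"
| "truncation S A (Suc n) p =
     (if converges S p \<and> (\<forall>a q. (p, a, q) \<in> steps S \<longrightarrow> a \<in> A) then Sum else SumOmega)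
       (SOME ts. set ts = {(a, truncation S A n q) | a q. (p, a, q) \<in> steps S \<and> a \<in> A})"

text \<open>A process may have infinitely many steps even under one action, so finiteness comes from
  counting trees: one at depth 0, and at depth \<open>Suc n\<close> at most two for each subset of
  the finite set \<open>A \<times> range (truncation S A n)\<close>.\<close>

lemma finite_range_truncation:
  assumes "finite A"
  shows "finite (range (truncation S A n))"
proof (induction n)
  case (Suc n)
  let ?P = "Pow (A \<times> range (truncation S A n))"
  have "range (truncation S A (Suc n)) \<subseteq>
      (\<lambda>X. Sum (SOME ts. set ts = X)) ` ?P \<union> (\<lambda>X. SumOmega (SOME ts. set ts = X)) ` ?P"
  proof
    fix t assume "t \<in> range (truncation S A (Suc n))"
    then obtain p where t: "t = truncation S A (Suc n) p" ..
    define X where "X = {(a, truncation S A n q) | a q. (p, a, q) \<in> steps S \<and> a \<in> A}"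
    have "X \<in> ?P"
      by (auto simp: X_def)
    moreover have "t = Sum (SOME ts. set ts = X) \<or> t = SumOmega (SOME ts. set ts = X)"
      unfolding t truncation.simps(2) X_def [symmetric] by (simp split: if_split)
    ultimately show "t \<in> (\<lambda>X. Sum (SOME ts. set ts = X)) ` ?P \<union>
        (\<lambda>X. SumOmega (SOME ts. set ts = X)) ` ?P"
      by blast
  qed
  moreover have "finite ?P"
    using assms Suc by simp
  ultimately show ?case
    by (meson finite_UnI finite_imageI finite_subset)
qed simp

text \<open>Only a finite set is enumerated by a list, so the choice in \<open>truncation\<close> is
  meaningful because the truncations at depth \<open>n\<close> are finite in number.\<close>

lemma summands_truncation:
  assumes "finite A"
  shows "set (summands (truncation S A (Suc n) p)) =
    {(a, truncation S A n q) | a q. (p, a, q) \<in> steps S \<and> a \<in> A}" (is "_ = ?X")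
proof -
  have "?X \<subseteq> A \<times> range (truncation S A n)"
    by auto
  then have "finite ?X"
    using assms finite_range_truncation by (meson finite_SigmaI finite_subset)
  then have "\<exists>ts. set ts = ?X"
    by (rule finite_list)
  then have "set (SOME ts. set ts = ?X) = ?X"
    by (rule someI_ex)
  then show ?thesis by simp
qed

lemma converges_truncation:
  "converges tree_system (truncation S A (Suc n) p) \<longleftrightarrow>
    converges S p \<and> (\<forall>a q. (p, a, q) \<in> steps S \<longrightarrow> a \<in> A)"
  by simp

text \<open>The relation ranges over all depths, since each step lowers the depth by one. Its
  backward clause holds because a convergent truncation has dropped no action of
  \<open>p\<close>.\<close>

lemma truncation_below:
  assumes "finite A"
  shows "prebisimilar_across tree_system S (truncation S A n p) p"
proof (rule prebisimilar_across_coinduct [where R = "\<lambda>t p. \<exists>n. t = truncation S A n p"])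
  fix t p assume "\<exists>n. t = truncation S A n p"
  then obtain n where t: "t = truncation S A n p" ..
  show "\<exists>q. (p, a, q) \<in> steps S \<and> (\<exists>n. t' = truncation S A n q)"
    if "(t, a, t') \<in> steps tree_system" for a t'
    using that t
      by (cases n) (auto simp del: truncation.simps(2) simp add: summands_truncation [OF assms])
  show "converges S p" if "converges tree_system t"
    using that t by (cases n) (auto split: if_splits)
  show "\<exists>t'. (t, a, t') \<in> steps tree_system \<and> (\<exists>n. t' = truncation S A n q)"
    if conv: "converges tree_system t" and step: "(p, a, q) \<in> steps S" for a q
  proof (cases n)
    case (Suc m)
    then have "a \<in> A"
      using conv step t converges_truncation by metis
    then show ?thesis
      using step t Suc
      by (auto simp del: truncation.simps(2) simp add: summands_truncation [OF assms])
  qed (use conv t in simp)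
qed blast

section \<open>Truncation preserves satisfaction\<close>

text \<open>A \<open>Prefix\<close> in \<open>\<psi>\<close> that is not nested under another names
  an action other than \<open>a\<close>, so it fails at \<open>Cap a p\<close> as it does at
  \<open>Bot\<close>.\<close>

lemma sat_kappa_fresh_action:
  fixes \<phi> :: "'a pi_formula" and \<psi> :: "'a kappa_formula"
  shows "True" and "sat_kappa S (Cap a p) \<psi> \<Longrightarrow> a \<notin> set_kappa_formula \<psi> \<Longrightarrow> sat_kappa T c \<psi>"
  by (induction \<phi> and \<psi>) auto

fun truncate_capability ::
  "('p, 'a) transition_system \<Rightarrow> 'a set \<Rightarrow> nat \<Rightarrow> ('p, 'a) capability \<Rightarrow>
    ('a sync_tree, 'a) capability" where
  "truncate_capability S A n Bot = Bot"
| "truncate_capability S A n (Cap a p) = Cap a (truncation S A n p)"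

lemma size_le_size_list: "x \<in> set xs \<Longrightarrow> size x \<le> size_list size xs"
  by (simp add: size_list_estimation')

text \<open>The size bounds the modal depth and drops at every constructor, so it serves as the
  depth of the truncation; only \<open>Box\<close> and \<open>Diamond\<close> use up a
  level.\<close>

lemma sat_truncation:
  fixes \<phi> :: "'a pi_formula" and \<psi> :: "'a kappa_formula"
  assumes "finite A"
  shows sat_pi_truncation: "sat_pi S p \<phi> \<Longrightarrow> set_pi_formula \<phi> \<subseteq> A \<Longrightarrow> size \<phi> \<le> n \<Longrightarrow>
      sat_pi tree_system (truncation S A n p) \<phi>"
    and sat_kappa_truncation: "sat_kappa S c \<psi> \<Longrightarrow> set_kappa_formula \<psi> \<subseteq> A \<Longrightarrow> size \<psi> \<le> n \<Longrightarrow>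
      sat_kappa tree_system (truncate_capability S A n c) \<psi>"
proof (induction \<phi> and \<psi> arbitrary: n p and n c)
  case (PiConj \<phi>s)
  have "set_pi_formula \<phi> \<subseteq> A \<and> size \<phi> \<le> n" if "\<phi> \<in> set \<phi>s" for \<phi>
    using PiConj.prems(2,3) size_le_size_list [OF that] that by auto
  then show ?case
    using PiConj.IH PiConj.prems(1) by (simp del: truncation.simps)
next
  case (PiDisj \<phi>s)
  have "set_pi_formula \<phi> \<subseteq> A \<and> size \<phi> \<le> n" if "\<phi> \<in> set \<phi>s" for \<phi>
    using PiDisj.prems(2,3) size_le_size_list [OF that] that by auto
  then show ?case
    using PiDisj.IH PiDisj.prems(1) by (simp del: truncation.simps) blast
next
  case (Box \<psi>)
  then obtain m where n: "n = Suc m" and m: "size \<psi> \<le> m"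
    by (cases n) auto
  let ?t = "truncation S A n p"
  show ?case
  proof (cases "converges tree_system ?t")
    case True
    have "sat_kappa tree_system d \<psi>" if d: "d \<in> capabilities tree_system ?t" for d
    proof (cases d)
      case Bot
      then show ?thesis using d True by simp
    next
      case (Cap a t)
      then obtain q where q: "(p, a, q) \<in> steps S" "t = truncation S A m q"
        using d n by (auto simp del: truncation.simps simp add: summands_truncation [OF assms])
      then have "sat_kappa S (Cap a q) \<psi>"
        using Box.prems(1) by simp
      then show ?thesis
        using Box.IH [of "Cap a q" m] Box.prems(2) m q Cap by simp
    qed
    then show ?thesis by simp
  next
    case False
    \<comment> \<open>A truncation diverges either with \<open>p\<close> or because an action was
      dropped. Both times \<open>\<psi>\<close> holds at \<open>Bot\<close>, so the new divergence
      does no harm.\<close>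
    then consider "\<not> converges S p" | a q where "(p, a, q) \<in> steps S" "a \<notin> A"
      unfolding n converges_truncation by blast
    then have "sat_kappa S Bot \<psi>"
    proof cases
      case 1
      then show ?thesis using Box.prems(1) by simp
    next
      case 2
      then show ?thesis
        using Box.prems(1,2) sat_kappa_fresh_action(2) [of S a q \<psi>] by auto
    qed
    then show ?thesis by (auto intro: sat_kappa_Bot(2))
  qed
next
  case (Diamond \<psi>)
  then obtain m where n: "n = Suc m" and m: "size \<psi> \<le> m"
    by (cases n) auto
  obtain c where c: "c \<in> capabilities S p \<union> {Bot}" "sat_kappa S c \<psi>"
    using Diamond.prems(1) by auto
  show ?case
  \<comment> \<open>If \<open>\<psi>\<close> fails at \<open>Bot\<close>, the witness is a step
    whose action occurs in \<open>\<psi>\<close>, and this step survives the truncation.\<close>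
  proof (cases "sat_kappa S Bot \<psi>")
    case True
    then show ?thesis by (auto intro: sat_kappa_Bot(2))
  next
    case False
    then obtain a q where q: "c = Cap a q" "(p, a, q) \<in> steps S"
      using c by (cases c) auto
    moreover have "a \<in> A"
      using False Diamond.prems(2) c(2) q sat_kappa_fresh_action(2) [of S a q \<psi>] by auto
    ultimately have "Cap a (truncation S A m q) \<in> capabilities tree_system (truncation S A n p)"
      using n by (auto simp del: truncation.simps simp add: summands_truncation [OF assms])
    then show ?thesis
      using Diamond.IH [OF c(2), of m] Diamond.prems(2) m q by auto
  qed
next
  case (KappaConj \<psi>s)
  have "set_kappa_formula \<psi> \<subseteq> A \<and> size \<psi> \<le> n" if "\<psi> \<in> set \<psi>s" for \<psi>
    using KappaConj.prems(2,3) size_le_size_list [OF that] that by auto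
  then show ?case
    using KappaConj.IH KappaConj.prems(1) by (simp del: truncation.simps)
next
  case (KappaDisj \<psi>s)
  have "set_kappa_formula \<psi> \<subseteq> A \<and> size \<psi> \<le> n" if "\<psi> \<in> set \<psi>s" for \<psi>
    using KappaDisj.prems(2,3) size_le_size_list [OF that] that by auto
  then show ?case
    using KappaDisj.IH KappaDisj.prems(1) by (simp del: truncation.simps) blast
next
  case (Prefix a \<phi>)
  then show ?case by auto
qed

lemma finite_set_formula:
  fixes \<phi> :: "'a pi_formula" and \<psi> :: "'a kappa_formula"
  shows "finite (set_pi_formula \<phi>)" and "finite (set_kappa_formula \<psi>)"
  by (induction \<phi> and \<psi>) auto

theorem mainTheorem6:
  fixes S :: "('p, 'a) transition_system" and p q :: 'p
  shows "finitary_preorder S p q \<longleftrightarrow> finitary_theory S p \<subseteq> finitary_theory S q"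
proof
  assume *: "finitary_preorder S p q"
  show "finitary_theory S p \<subseteq> finitary_theory S q"
  proof
    fix \<phi> assume "\<phi> \<in> finitary_theory S p"
    then have \<phi>: "sat_pi S p \<phi>"
      by (simp add: finitary_theory_def)
    \<comment> \<open>A finite tree below \<open>p\<close> that still satisfies
      \<open>\<phi>\<close>: the preorder puts it below \<open>q\<close>, and monotonicity carries
      \<open>\<phi>\<close> to \<open>q\<close>.\<close>
    let ?t = "truncation S (set_pi_formula \<phi>) (size \<phi>) p"
    have "prebisimilar_across tree_system S ?t q"
      using * truncation_below [OF finite_set_formula(1), of S \<phi> "size \<phi>" p]
      unfolding finitary_preorder_def by blast
    moreover have "sat_pi tree_system ?t \<phi>"
      using sat_pi_truncation [OF finite_set_formula(1) \<phi>] by simp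
    ultimately show "\<phi> \<in> finitary_theory S q"
      by (auto simp: finitary_theory_def intro: sat_pi_mono)
  qed
next
  assume "finitary_theory S p \<subseteq> finitary_theory S q"
  \<comment> \<open>Lying above \<open>t\<close> amounts to satisfying
    \<open>char_formula t\<close>, to which the inclusion applies.\<close>
  then show "finitary_preorder S p q"
    by (auto simp: finitary_theory_def finitary_preorder_def simp flip: sat_pi_char_formula)
qed

end
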